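(* For every integer $n\ge 1$, the orbicycle index polynomial of the cyclic group $\mathbb{Z}_n\subseteq S_n$ is $$P_{\mathbb{Z}_{n}}^{orb}(y_{1},y_{2},\dots,y_{n})=\frac{1}{n}\sum_{d\mid n}J_{2}(d)\,y_{d}^{\frac{n}{d}}.$$
   Context: $\mathbb{Z}_n=\{1,\dots,n\}$ is the cyclic group of order $n$ (integers modulo $n$), regarded as a subgroup of $S_n$ by acting on itself by translations. $J_k$ is the Jordan totient function $J_k(n)=|\{x\in\mathbb{Z}_n^k\mid (x,n)=1\}|$, where $(x,n)$ is the greatest common divisor of $x_1,\dots,x_k,n$. For a finite group $G\subseteq S_m$: $C(G)$ is the set of conjugacy classes of $G$, with a fixed representative $g$ for each class $\overline{g}$, and $|\overline{g}|$ is the number of elements of the class; $Z(g)$ is the centralizer of $g$ in $G$; $P(G)=\{(\overline{g},h)\mid\overline{g}\in C(G),\ h\in Z(g)\}$. For $g\in S_m$, $C(g)$ denotes the partition of $[m]=\{1,\dots,m\}$ into the cycles (orbits, including fixed points) of $g$; $\pi\vee\rho$ is the join of partitions (the finest partition coarser than both $\pi$ and $\rho$); $b_k(\pi)$ is the number of blocks of $\pi$ of cardinality $k$. The orbicycle index polynomial of $G$ is $$P_{G}^{orb}(y_1,y_2,\dots)=\frac{1}{|G|}\sum_{(\overline{g},h)\in P(G)}|\overline{g}|\prod_{k\ge1}y_k^{b_k(C(g)\vee C(h))}\in\mathbb{Q}[y_1,y_2,\dots].$$ *)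

theory Defs
  imports
    Complex_Main
    "HOL-Algebra.Sym_Groups"
    "HOL-Combinatorics.Orbits"
    "HOL-Library.Disjoint_Sets"
    "HOL-Library.Poly_Mapping"
begin

text \<open>
  The polynomial ring \<open>\<rat>[y\<^sub>1, y\<^sub>2, \<dots>]\<close> is the monoid algebra over the exponent vectors
  \<open>nat \<Rightarrow>\<^sub>0 nat\<close>, with the convolution product of \<^theory>\<open>HOL-Library.Poly_Mapping\<close>.
\<close>

type_synonym rat_mpoly = "(nat \<Rightarrow>\<^sub>0 nat) \<Rightarrow>\<^sub>0 rat"

definition poly_const :: "rat \<Rightarrow> rat_mpoly" where
  "poly_const c = Poly_Mapping.single 0 c"

definition poly_var :: "nat \<Rightarrow> rat_mpoly" where
  "poly_var k = Poly_Mapping.single (Poly_Mapping.single k 1) 1"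

definition jordan_totient :: "nat \<Rightarrow> nat \<Rightarrow> nat" where
  "jordan_totient k n =
     card {xs :: nat list. length xs = k \<and> set xs \<subseteq> {1..n} \<and> Gcd (insert n (set xs)) = 1}"

definition conj_class :: "('a, 'b) monoid_scheme \<Rightarrow> 'a \<Rightarrow> 'a set" where
  "conj_class G g = {h \<otimes>\<^bsub>G\<^esub> g \<otimes>\<^bsub>G\<^esub> inv\<^bsub>G\<^esub> h | h. h \<in> carrier G}"

definition conj_classes :: "('a, 'b) monoid_scheme \<Rightarrow> 'a set set" where
  "conj_classes G = conj_class G ` carrier G"

definition elt_centralizer :: "('a, 'b) monoid_scheme \<Rightarrow> 'a \<Rightarrow> 'a set" where
  "elt_centralizer G g = {h \<in> carrier G. h \<otimes>\<^bsub>G\<^esub> g = g \<otimes>\<^bsub>G\<^esub> h}"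

text \<open>
  A choice of representatives of the conjugacy classes is a function from classes to elements.
\<close>

definition is_class_rep :: "('a, 'b) monoid_scheme \<Rightarrow> ('a set \<Rightarrow> 'a) \<Rightarrow> bool" where
  "is_class_rep G rep \<longleftrightarrow> (\<forall>c \<in> conj_classes G. rep c \<in> c)"

definition commuting_class_pairs ::
    "('a, 'b) monoid_scheme \<Rightarrow> ('a set \<Rightarrow> 'a) \<Rightarrow> ('a set \<times> 'a) set" where
  "commuting_class_pairs G rep = (SIGMA c : conj_classes G. elt_centralizer G (rep c))"

text \<open>
  The theory \<open>Orbits\<close> generates an orbit from \<open>p x\<close> rather than from \<open>x\<close>; the two agree because
  a permutation of \<open>{1..m}\<close> has finite order.
\<close>

definition cycle_partition :: "nat \<Rightarrow> (nat \<Rightarrow> nat) \<Rightarrow> nat set set" where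
  "cycle_partition m p = Orbits.orbit p ` {1..m}"

definition is_partition_join :: "'a set \<Rightarrow> 'a set set \<Rightarrow> 'a set set \<Rightarrow> 'a set set \<Rightarrow> bool" where
  "is_partition_join A P Q R \<longleftrightarrow> refines A P R \<and> refines A Q R \<and>
     (\<forall>S. refines A P S \<and> refines A Q S \<longrightarrow> refines A R S)"

definition partition_join :: "'a set \<Rightarrow> 'a set set \<Rightarrow> 'a set set \<Rightarrow> 'a set set" where
  "partition_join A P Q = (THE R. is_partition_join A P Q R)"

definition num_blocks :: "nat \<Rightarrow> 'a set set \<Rightarrow> nat" where
  "num_blocks k P = card {B \<in> P. card B = k}"

text \<open>
  Below, \<open>m\<close> is the degree and \<open>G\<close> the underlying set of a subgroup of \<open>S\<^sub>m\<close>.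
  A block of a partition of \<open>{1..m}\<close> has at most \<open>m\<close> elements, so the product over all
  \<open>k \<ge> 1\<close> only involves \<open>k \<le> m\<close>.
\<close>

abbreviation perm_group :: "nat \<Rightarrow> (nat \<Rightarrow> nat) set \<Rightarrow> (nat \<Rightarrow> nat) monoid" where
  "perm_group m G \<equiv> (sym_group m)\<lparr>carrier := G\<rparr>"

definition orbicycle_index ::
    "nat \<Rightarrow> (nat \<Rightarrow> nat) set \<Rightarrow> ((nat \<Rightarrow> nat) set \<Rightarrow> nat \<Rightarrow> nat) \<Rightarrow> rat_mpoly" where
  "orbicycle_index m G rep =
     poly_const (1 / of_nat (card G)) *
     (\<Sum>(c, h) \<in> commuting_class_pairs (perm_group m G) rep.
        of_nat (card c) *
        (\<Prod>k = 1..m. poly_var k ^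
           num_blocks k
             (partition_join {1..m} (cycle_partition m (rep c)) (cycle_partition m h))))"

text \<open>
  \<open>\<int>\<^sub>n = {1..n}\<close> acting on itself: \<open>x\<close> goes to the representative of \<open>x + a\<close> in \<open>{1..n}\<close>,
  and points outside \<open>{1..n}\<close> are fixed, as the elements of \<^const>\<open>sym_group\<close> require.
\<close>

definition translation :: "nat \<Rightarrow> nat \<Rightarrow> nat \<Rightarrow> nat" where
  "translation n a x = (if x \<in> {1..n} then (x + a - 1) mod n + 1 else x)"

definition cyclic_perms :: "nat \<Rightarrow> (nat \<Rightarrow> nat) set" where
  "cyclic_perms n = translation n ` {1..n}"

end

theory Submission
  imports Defs "HOL-Number_Theory.Cong"
begin

text \<open>
  In an abelian group every conjugacy class is a single element and every centralizer is the whole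
  group, so the orbicycle index averages over all pairs of group elements
  (\<open>sum_commuting_class_pairs\<close>). For the cyclic group these are the pairs of translations by
  \<open>a\<close> and \<open>b\<close>.

  The cycles of the translation by \<open>a\<close> are the cosets of the subgroup generated by \<open>a\<close>, that is,
  the residue classes modulo \<open>gcd a n\<close> (\<open>cycle_partition_translation\<close>). Joining the partitions
  for \<open>a\<close> and \<open>b\<close> gives the cosets of the subgroup generated by both, the residue classes modulo
  \<open>c = gcd (gcd a n) (gcd b n)\<close> (\<open>partition_join_residue_partition\<close>). There are \<open>c\<close> of them, each
  of size \<open>n div c\<close>, so the pair contributes the monomial \<open>y\<^sub>d ^ (n div d)\<close> with \<open>d = n div c\<close>.

  Collecting equal monomials, it remains to count the pairs with \<open>c = n div d\<close>. Dividing both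
  entries by \<open>n div d\<close> turns them into the pairs in \<open>{1..d}\<close> without a common factor with \<open>d\<close>,
  which are what \<open>J\<^sub>2(d)\<close> counts (\<open>card_pairs_gcd_eq_jordan_totient\<close>).
\<close>

section \<open>Translations of the cyclic group\<close>

lemma residue_representative_unique:
  fixes x y n :: nat
  assumes "x \<in> {1..n}" "y \<in> {1..n}" "[x = y] (mod n)"
  shows "x = y"
proof -
  have "[(x - 1) + 1 = (y - 1) + 1] (mod n)" using assms by simp
  then have "[x - 1 = y - 1] (mod n)" by (simp only: cong_add_rcancel_nat)
  moreover have "x - 1 < n" "y - 1 < n" using assms by auto
  ultimately have "x - 1 = y - 1" by (simp add: cong_def)
  with assms show ?thesis by auto
qed

lemma translation_in_range: "x \<in> {1..n} \<Longrightarrow> translation n a x \<in> {1..n}"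
  by (auto simp: translation_def Suc_le_eq)

lemma translation_cong:
  assumes "x \<in> {1..n}"
  shows "[translation n a x = x + a] (mod n)"
proof -
  have "[(x + a - 1) mod n + 1 = (x + a - 1) + 1] (mod n)"
    by (intro cong_add) (auto simp: cong_def)
  with assms show ?thesis by (simp add: translation_def)
qed

text \<open>
  A translation is determined by its congruence property, since \<open>{1..n}\<close> contains one
  representative of each residue class. This reduces identities between translations to
  congruences.
\<close>
lemma translation_eqI:
  assumes "x \<in> {1..n}" "y \<in> {1..n}" "[y = x + a] (mod n)"
  shows "translation n a x = y"
  using residue_representative_unique[OF translation_in_range[OF assms(1)] assms(2)]
    translation_cong[OF assms(1)] assms(3) cong_sym cong_trans by blast

lemma translation_0: "translation n 0 = id"
proof
  fix x show "translation n 0 x = id x"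
    by (cases "x \<in> {1..n}") (simp add: translation_eqI, auto simp: translation_def)
qed

lemma translation_translation: "translation n a (translation n b x) = translation n (a + b) x"
proof (cases "x \<in> {1..n}")
  case True
  have "[translation n (a + b) x = translation n b x + a] (mod n)"
    using cong_add[OF translation_cong[OF True, of b] cong_refl[of a]]
      translation_cong[OF True, of "a + b"]
    by (metis add.assoc add.commute cong_sym cong_trans)
  with True show ?thesis by (intro translation_eqI translation_in_range)
qed (auto simp: translation_def)

lemma translation_comp: "translation n a \<circ> translation n b = translation n (a + b)"
  by (auto simp: translation_translation)

lemma funpow_translation: "translation n a ^^ k = translation n (k * a)"
  by (induction k) (auto simp: translation_0 translation_comp)

lemma translation_eq_iff:
  assumes "n \<ge> 1"
  shows "translation n a = translation n b \<longleftrightarrow> [a = b] (mod n)"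
proof
  assume "translation n a = translation n b"
  then have "[1 + a = 1 + b] (mod n)"
    using assms translation_cong[of 1 n a] translation_cong[of 1 n b]
    by (metis atLeastAtMost_iff cong_sym cong_trans order_refl)
  then show "[a = b] (mod n)" by (simp only: cong_add_lcancel_nat)
next
  assume ab: "[a = b] (mod n)"
  show "translation n a = translation n b"
  proof
    fix x show "translation n a x = translation n b x"
    proof (cases "x \<in> {1..n}")
      case True
      have "[x + b = x + a] (mod n)" using ab by (intro cong_add cong_refl) (rule cong_sym)
      with translation_cong[OF True] have "[translation n b x = x + a] (mod n)"
        by (rule cong_trans)
      with True show ?thesis by (intro translation_eqI translation_in_range)
    qed (auto simp: translation_def)
  qed
qed

lemma cyclic_perms_eq_range:
  assumes "n \<ge> 1"
  shows "cyclic_perms n = range (translation n)"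
proof -
  have "translation n a \<in> cyclic_perms n" for a
  proof -
    have "1 \<in> {1..n}" using assms by simp
    let ?b = "(a + n - 1) mod n + 1"
    have "[?b = (a + n - 1) + 1] (mod n)"
      by (intro cong_add) (auto simp: cong_def)
    then have "[a = ?b] (mod n)" using assms by (simp add: cong_def)
    moreover have "?b \<in> {1..n}" using assms by (auto simp: Suc_le_eq)
    ultimately show ?thesis
      unfolding cyclic_perms_def using translation_eq_iff[OF assms] by blast
  qed
  then show ?thesis by (auto simp: cyclic_perms_def)
qed

lemma inj_on_translation: "inj_on (translation n) {1..n}"
proof (cases "n \<ge> 1")
  case True
  then show ?thesis
    by (auto simp: inj_on_def translation_eq_iff intro: residue_representative_unique)
qed auto

lemma card_cyclic_perms: "card (cyclic_perms n) = n"
  unfolding cyclic_perms_def by (subst card_image[OF inj_on_translation]) simp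

lemma comm_group_cyclic_perms:
  assumes "n \<ge> 1"
  shows "comm_group (perm_group n (cyclic_perms n))"
proof (rule comm_groupI)
  fix g assume "g \<in> carrier (perm_group n (cyclic_perms n))"
  then obtain a where g: "g = translation n a"
    by (auto simp: cyclic_perms_eq_range[OF assms])
  have "translation n ((n - 1) * a) \<circ> g = translation n (n * a)"
    using assms by (simp add: g translation_comp algebra_simps diff_mult_distrib)
  also have "\<dots> = translation n 0"
    using assms by (simp only: translation_eq_iff) (simp add: cong_def)
  finally show "\<exists>h\<in>carrier (perm_group n (cyclic_perms n)).
      h \<otimes>\<^bsub>perm_group n (cyclic_perms n)\<^esub> g = \<one>\<^bsub>perm_group n (cyclic_perms n)\<^esub>"
    by (auto simp: cyclic_perms_eq_range[OF assms] sym_group_mult sym_group_one translation_0)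
next
  show "\<one>\<^bsub>perm_group n (cyclic_perms n)\<^esub> \<in> carrier (perm_group n (cyclic_perms n))"
    by (simp add: cyclic_perms_eq_range[OF assms] sym_group_one)
      (metis rangeI translation_0)
qed (auto simp: cyclic_perms_eq_range[OF assms] sym_group_mult sym_group_one translation_comp
      add.commute comp_assoc)

section \<open>Sums over commuting pairs in an abelian group\<close>

lemma (in comm_group) conj_class_eq_singleton:
  assumes "g \<in> carrier G"
  shows "conj_class G g = {g}"
proof -
  have "h \<otimes> g \<otimes> inv h = g" if "h \<in> carrier G" for h
    using assms that by (metis inv_closed inv_solve_right m_closed m_comm)
  then have "(\<lambda>h. h \<otimes> g \<otimes> inv h) ` carrier G = (\<lambda>h. g) ` carrier G"
    by (rule image_cong[OF refl])
  then have "conj_class G g = (\<lambda>h. g) ` carrier G"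
    by (simp only: conj_class_def Setcompr_eq_image)
  then show ?thesis using one_closed by auto
qed

text \<open>
  The choice of representatives disappears because \<open>rep {g}\<close> can only be \<open>g\<close>.
\<close>
lemma (in comm_group) sum_commuting_class_pairs:
  assumes "finite (carrier G)" "is_class_rep G rep"
  shows "(\<Sum>(c, h) \<in> commuting_class_pairs G rep. of_nat (card c) * f (rep c) h) =
    (\<Sum>g \<in> carrier G. \<Sum>h \<in> carrier G. (f g h :: 'c :: semiring_1))"
proof -
  have classes: "conj_classes G = (\<lambda>g. {g}) ` carrier G"
    by (simp add: conj_classes_def conj_class_eq_singleton)
  then have rep: "rep {g} = g" if "g \<in> carrier G" for g
    using assms(2) that by (auto simp: is_class_rep_def)
  have centralizer: "elt_centralizer G g = carrier G" if "g \<in> carrier G" for g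
    using that m_comm by (auto simp: elt_centralizer_def)
  have fin: "finite (elt_centralizer G x)" for x
    using assms(1) by (simp add: elt_centralizer_def)
  have "(\<Sum>(c, h) \<in> commuting_class_pairs G rep. of_nat (card c) * f (rep c) h) =
      (\<Sum>c \<in> conj_classes G. \<Sum>h \<in> elt_centralizer G (rep c). of_nat (card c) * f (rep c) h)"
    unfolding commuting_class_pairs_def
    by (subst sum.Sigma) (auto simp: classes assms(1) fin)
  also have "\<dots> = (\<Sum>g \<in> carrier G. \<Sum>h \<in> carrier G. f g h)"
    unfolding classes by (subst sum.reindex) (auto simp: inj_on_def rep centralizer)
  finally show ?thesis .
qed

section \<open>Partitions of an interval into residue classes\<close>

definition residue_class :: "nat \<Rightarrow> nat \<Rightarrow> nat \<Rightarrow> nat set" where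
  "residue_class n d x = {y \<in> {1..n}. [y = x] (mod d)}"

definition residue_partition :: "nat \<Rightarrow> nat \<Rightarrow> nat set set" where
  "residue_partition n d = residue_class n d ` {1..n}"

lemma partition_on_residue_partition: "partition_on {1..n} (residue_partition n d)"
proof (rule partition_onI)
  fix p q assume "p \<in> residue_partition n d" "q \<in> residue_partition n d" "p \<noteq> q"
  then show "disjnt p q"
    unfolding residue_partition_def residue_class_def disjnt_def cong_def by auto
qed (auto simp: residue_partition_def residue_class_def)

text \<open>
  Starting from \<open>x\<close>, the translation by \<open>a\<close> reaches \<open>y\<close> in \<open>k\<close> steps iff
  \<open>a * k\<close> is congruent to \<open>y - x\<close> modulo \<open>n\<close>, and this linear congruence is solvable iff
  \<open>gcd a n\<close> divides \<open>y - x\<close>.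
\<close>
lemma orbit_translation:
  assumes "x \<in> {1..n}"
  shows "Orbits.orbit (translation n a) x = residue_class n (gcd a n) x"
proof (intro equalityI subsetI)
  fix y assume "y \<in> Orbits.orbit (translation n a) x"
  then obtain k where y: "y = translation n (k * a) x"
    by (auto simp: Orbits.orbit_altdef funpow_translation)
  have "[y = x + k * a] (mod gcd a n)"
    using cong_dvd_modulus_nat[OF translation_cong[OF assms, of "k * a"], of "gcd a n"] y by simp
  also have "[x + k * a = x + 0] (mod gcd a n)"
    by (intro cong_add cong_refl) (simp add: cong_0_iff)
  finally show "y \<in> residue_class n (gcd a n) x"
    using y translation_in_range[OF assms] by (simp add: residue_class_def)
next
  fix y assume "y \<in> residue_class n (gcd a n) x"
  then have y: "y \<in> {1..n}" "[y = x] (mod gcd a n)" by (auto simp: residue_class_def)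
  have n: "n \<ge> 1" using assms by auto
  \<comment> \<open>Adding \<open>(n - 1) * x\<close> is subtraction of \<open>x\<close> modulo \<open>n\<close>, without leaving the naturals.\<close>
  have nx: "(n - 1) * x + x = n * x" using n by (simp add: algebra_simps diff_mult_distrib)
  have "[y + (n - 1) * x = x + (n - 1) * x] (mod gcd a n)"
    by (intro cong_add y cong_refl)
  also have "x + (n - 1) * x = n * x" using nx by simp
  also have "[n * x = 0] (mod gcd a n)" by (simp add: cong_0_iff)
  finally have "gcd a n dvd y + (n - 1) * x" by (simp add: cong_0_iff)
  then obtain k where k: "[a * k = y + (n - 1) * x] (mod n)"
    using cong_solve_dvd_nat by blast
  \<comment> \<open>The summand \<open>n\<close> makes the number of steps positive.\<close>
  have "[x + (k + n) * a = x + (a * k + 0)] (mod n)"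
    by (intro cong_add cong_refl) (simp add: cong_def algebra_simps)
  also have "[x + (a * k + 0) = x + (y + (n - 1) * x)] (mod n)"
    by (simp only: add_0_right cong_add_lcancel_nat k)
  also have "x + (y + (n - 1) * x) = y + n * x" using nx by simp
  also have "[y + n * x = y] (mod n)" by (simp add: cong_def)
  finally have "translation n ((k + n) * a) x = y"
    using assms y(1) by (intro translation_eqI) (auto intro: cong_sym)
  then show "y \<in> Orbits.orbit (translation n a) x"
    using n by (auto simp: Orbits.orbit_altdef funpow_translation intro!: exI[of _ "k + n"])
qed

lemma cycle_partition_translation:
  "cycle_partition n (translation n a) = residue_partition n (gcd a n)"
  unfolding cycle_partition_def residue_partition_def
  by (rule image_cong[OF refl]) (rule orbit_translation)

text \<open>
  The Chinese remainder theorem for moduli that need not be coprime: the system is solvable as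
  soon as its right-hand sides agree modulo \<open>gcd d e\<close>. Since \<open>d\<close> and \<open>e\<close> divide \<open>n\<close>, the solution
  can be reduced into \<open>{1..n}\<close>.
\<close>
lemma simultaneous_congruence:
  fixes x y d e n :: nat
  assumes "n \<ge> 1" "d dvd n" "e dvd n" "[x = y] (mod gcd d e)"
  obtains z where "z \<in> {1..n}" "[z = x] (mod d)" "[z = y] (mod e)"
proof -
  have "[int x = int y] (mod gcd (int d) (int e))"
    using assms(4) by (metis cong_int_iff gcd_int_int_eq)
  then have "gcd (int d) (int e) dvd int y - int x"
    by (metis cong_iff_dvd_diff cong_sym)
  then obtain k where k: "[int d * k = int y - int x] (mod int e)"
    using cong_solve_dvd_int by blast
  let ?w = "int x + int d * k"
  define z where "z = nat ((?w - 1) mod int n) + 1"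
  have "(?w - 1) mod int n < int n" "(?w - 1) mod int n \<ge> 0" using assms(1) by auto
  then have z: "z \<in> {1..n}" and iz: "int z = (?w - 1) mod int n + 1"
    by (auto simp: z_def)
  have "[int z = ?w] (mod int n)"
    unfolding iz using cong_add[of "(?w - 1) mod int n" "?w - 1" "int n" 1 1]
    by (simp add: cong_def mod_simps)
  then have zd: "[int z = ?w] (mod int d)" and ze: "[int z = ?w] (mod int e)"
    using assms(2,3) by (meson cong_dvd_modulus of_nat_dvd_iff)+
  note zd
  also have "[?w = int x] (mod int d)" by (simp add: cong_def)
  finally have "[z = x] (mod d)" by (simp add: cong_int_iff)
  moreover have "[?w = int x + (int y - int x)] (mod int e)"
    using k by (intro cong_add) auto
  with ze have "[int z = int y] (mod int e)" by (auto intro: cong_trans)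
  then have "[z = y] (mod e)" by (simp add: cong_int_iff)
  ultimately show ?thesis using z that by blast
qed

lemma refines_residue_partition:
  assumes "e dvd d"
  shows "refines {1..n} (residue_partition n d) (residue_partition n e)"
  unfolding refines_def
proof (intro conjI ballI partition_on_residue_partition)
  fix X assume "X \<in> residue_partition n d"
  then obtain x where "x \<in> {1..n}" "X = residue_class n d x"
    by (auto simp: residue_partition_def)
  moreover from this have "X \<subseteq> residue_class n e x"
    using assms cong_dvd_modulus_nat by (auto simp: residue_class_def)
  ultimately show "\<exists>Y\<in>residue_partition n e. X \<subseteq> Y"
    by (auto simp: residue_partition_def)
qed

lemma refines_residue_partition_same_block:
  assumes "refines {1..n} (residue_partition n d) S" "B \<in> S" "x \<in> B" "y \<in> {1..n}"
    "[y = x] (mod d)"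
  shows "y \<in> B"
proof -
  have S: "partition_on {1..n} S" using assms(1) by (simp add: refines_def)
  have x: "x \<in> {1..n}" using S assms(2,3) by (auto simp: partition_on_def)
  then have "residue_class n d x \<in> residue_partition n d" by (simp add: residue_partition_def)
  then obtain C where C: "C \<in> S" "residue_class n d x \<subseteq> C"
    using assms(1) by (auto simp: refines_def)
  have "x \<in> C" "y \<in> C" using C(2) x assms(4,5) by (auto simp: residue_class_def)
  moreover have "C = B"
    using S C(1) assms(2,3) \<open>x \<in> C\<close> unfolding partition_on_def disjoint_def by blast
  ultimately show ?thesis by simp
qed

lemma partition_join_eqI:
  assumes "is_partition_join A P Q R"
  shows "partition_join A P Q = R"
  unfolding partition_join_def
proof (rule the_equality[where P = "is_partition_join A P Q", OF assms])
  fix S assume "is_partition_join A P Q S"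
  with assms show "S = R"
    unfolding is_partition_join_def by (meson refines_asym)
qed

text \<open>
  The two congruence relations permute, by the Chinese remainder step above, so the join needs no
  chains: \<open>x\<close> and \<open>y\<close> congruent modulo \<open>gcd d e\<close> are linked through a single \<open>z\<close>, which any
  partition coarser than both puts in the block of \<open>x\<close> and in that of \<open>y\<close>.
\<close>
lemma partition_join_residue_partition:
  assumes "n \<ge> 1" "d dvd n" "e dvd n"
  shows "partition_join {1..n} (residue_partition n d) (residue_partition n e) =
    residue_partition n (gcd d e)"
proof -
  let ?R = "residue_partition n (gcd d e)"
  have least: "refines {1..n} ?R S"
    if S: "refines {1..n} (residue_partition n d) S" "refines {1..n} (residue_partition n e) S"
    for S
    unfolding refines_def
  proof (intro conjI ballI partition_on_residue_partition)
    show part: "partition_on {1..n} S" using S by (simp add: refines_def)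
    fix X assume "X \<in> ?R"
    then obtain x where x: "x \<in> {1..n}" "X = residue_class n (gcd d e) x"
      by (auto simp: residue_partition_def)
    then obtain B where B: "B \<in> S" "x \<in> B" using part unfolding partition_on_def by blast
    have "y \<in> B" if y: "y \<in> X" for y
    proof -
      have "[x = y] (mod gcd d e)" "y \<in> {1..n}"
        using y x(2) by (auto simp: residue_class_def intro: cong_sym)
      then obtain z where "z \<in> {1..n}" "[z = x] (mod d)" "[z = y] (mod e)"
        using simultaneous_congruence[OF assms] by blast
      then show ?thesis
        using refines_residue_partition_same_block[OF S(1) B]
          refines_residue_partition_same_block[OF S(2) B(1)] \<open>y \<in> {1..n}\<close> cong_sym by blast
    qed
    then show "\<exists>Y\<in>S. X \<subseteq> Y" using B(1) by blast
  qed
  then have "is_partition_join {1..n} (residue_partition n d) (residue_partition n e) ?R"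
    using refines_residue_partition[OF gcd_dvd1] refines_residue_partition[OF gcd_dvd2]
    by (simp only: is_partition_join_def) blast
  then show ?thesis by (rule partition_join_eqI)
qed

text \<open>
  Cut \<open>{1..n}\<close> into \<open>n div d\<close> consecutive intervals of length \<open>d\<close>: the class has exactly one
  element in each, so numbering the intervals gives a bijection.
\<close>
lemma card_residue_class:
  assumes "n \<ge> 1" "d dvd n"
  shows "card (residue_class n d x) = n div d"
proof -
  obtain m where n: "n = d * m" using assms(2) by blast
  have d: "d \<ge> 1" using n assms(1) by (cases d) auto
  have "bij_betw (\<lambda>y. (y - 1) div d) (residue_class n d x) {..<m}"
  proof (rule bij_betwI')
    fix y z assume "y \<in> residue_class n d x" "z \<in> residue_class n d x"
    then have yz: "y \<ge> 1" "z \<ge> 1" "[y = z] (mod d)"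
      by (auto simp: residue_class_def cong_def)
    then have "[(y - 1) + 1 = (z - 1) + 1] (mod d)" by simp
    then have "(y - 1) mod d = (z - 1) mod d" by (simp only: cong_add_rcancel_nat) (simp add: cong_def)
    then show "((y - 1) div d = (z - 1) div d) \<longleftrightarrow> y = z"
      using yz by (metis div_mult_mod_eq le_add_diff_inverse)
  next
    fix y assume "y \<in> residue_class n d x"
    then have "y - 1 < d * m" using n assms by (auto simp: residue_class_def)
    then show "(y - 1) div d \<in> {..<m}" using d
      by (simp add: less_mult_imp_div_less mult.commute)
  next
    fix q assume q: "q \<in> {..<m}"
    \<comment> \<open>The offset of the class in an interval: \<open>r + 1\<close> represents \<open>x\<close> in \<open>{1..d}\<close>.\<close>
    define r where "r = (x + (d - 1)) mod d"
    let ?y = "q * d + r + 1"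
    have r: "r < d" using d by (simp add: r_def)
    have "q * d + r < Suc q * d" using r by simp
    also have "\<dots> \<le> m * d" using q by (intro mult_right_mono) auto
    finally have "?y \<in> {1..n}" using n by (simp add: mult.commute)
    moreover have "[?y = x] (mod d)"
    proof -
      have "[r + 1 = (x + (d - 1)) + 1] (mod d)"
        unfolding r_def by (intro cong_add) (auto simp: cong_def)
      then show ?thesis using d by (auto simp: cong_def add.assoc)
    qed
    moreover have "q = (?y - 1) div d" using r by simp
    ultimately show "\<exists>y\<in>residue_class n d x. q = (y - 1) div d"
      by (auto simp: residue_class_def)
  qed
  then have "card (residue_class n d x) = m" using bij_betw_same_card by fastforce
  then show ?thesis using n d by simp
qed

lemma card_residue_partition:
  assumes "n \<ge> 1" "d dvd n"
  shows "card (residue_partition n d) = d"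
proof -
  have "n div d * card (residue_partition n d) = card (\<Union>(residue_partition n d))"
  proof (rule card_partition)
    show "finite (residue_partition n d)" by (simp add: residue_partition_def)
    show "finite (\<Union>(residue_partition n d))"
      using partition_on_residue_partition[of n d] by (simp add: partition_on_def)
    show "card B = n div d" if "B \<in> residue_partition n d" for B
      using that card_residue_class[OF assms] by (auto simp: residue_partition_def)
    show "B \<inter> C = {}" if "B \<in> residue_partition n d" "C \<in> residue_partition n d" "B \<noteq> C" for B C
      using that partition_on_residue_partition[of n d]
      unfolding partition_on_def disjoint_def by blast
  qed
  also have "\<dots> = n"
    using partition_on_residue_partition[of n d] by (simp add: partition_on_def)
  finally have "n div d * card (residue_partition n d) = n div d * d" using assms by simp
  moreover have "n div d > 0" using assms by (auto simp: dvd_imp_le div_greater_zero_iff dvd_pos_nat)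
  ultimately show ?thesis by simp
qed

lemma num_blocks_residue_partition:
  assumes "n \<ge> 1" "d dvd n"
  shows "num_blocks k (residue_partition n d) = (if k = n div d then d else 0)"
proof -
  have "card B = n div d" if "B \<in> residue_partition n d" for B
    using that card_residue_class[OF assms] by (auto simp: residue_partition_def)
  then have "{B \<in> residue_partition n d. card B = k} =
      (if k = n div d then residue_partition n d else {})" by auto
  then show ?thesis by (simp add: num_blocks_def card_residue_partition[OF assms])
qed

lemma prod_power_num_blocks_residue_partition:
  fixes y :: "nat \<Rightarrow> 'a :: comm_semiring_1"
  assumes "n \<ge> 1" "d dvd n"
  shows "(\<Prod>k = 1..n. y k ^ num_blocks k (residue_partition n d)) = y (n div d) ^ d"
proof -
  have "n div d \<in> {1..n}"
    using assms by (auto simp: dvd_imp_le div_greater_zero_iff dvd_pos_nat Suc_le_eq)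
  have "(\<Prod>k = 1..n. y k ^ num_blocks k (residue_partition n d)) =
      (\<Prod>k = 1..n. if k = n div d then y k ^ d else 1)"
    by (intro prod.cong) (auto simp: num_blocks_residue_partition[OF assms])
  also have "\<dots> = y (n div d) ^ d" using \<open>n div d \<in> {1..n}\<close> by simp
  finally show ?thesis .
qed

section \<open>Counting pairs by greatest common divisor\<close>

text \<open>
  With \<open>e = n div d\<close>, the condition forces both entries to be multiples of \<open>e\<close>; multiplication by
  \<open>e\<close> is a bijection onto these pairs from the pairs in \<open>{1..d}\<close> that have no common factor with
  \<open>d\<close>.
\<close>
lemma card_pairs_gcd_eq_jordan_totient:
  assumes "n \<ge> 1" "d dvd n"
  shows "card {(a, b) \<in> {1..n} \<times> {1..n}. gcd (gcd a n) (gcd b n) = n div d} = jordan_totient 2 d"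
proof -
  obtain e where n: "n = d * e" using assms(2) by blast
  have pos: "d \<ge> 1" "e \<ge> 1" using n assms(1) by (cases d; cases e; auto)+
  let ?L = "{xs :: nat list. length xs = 2 \<and> set xs \<subseteq> {1..d} \<and> Gcd (insert d (set xs)) = 1}"
  let ?A = "{(a, b) \<in> {1..n} \<times> {1..n}. gcd (gcd a n) (gcd b n) = e}"
  have L: "?L = {[u, v] | u v. u \<in> {1..d} \<and> v \<in> {1..d} \<and> gcd (gcd u d) (gcd v d) = 1}"
    by (auto simp: length_Suc_conv numeral_2_eq_2 ac_simps)
  have gcd_scale: "gcd (gcd (u * e) n) (gcd (v * e) n) = gcd (gcd u d) (gcd v d) * e" for u v
    by (simp add: n gcd_mult_distrib_nat mult.commute)
  have "bij_betw (\<lambda>xs. (xs ! 0 * e, xs ! 1 * e)) ?L ?A"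
  proof (rule bij_betwI')
    fix xs ys assume "xs \<in> ?L" "ys \<in> ?L"
    then show "((xs ! 0 * e, xs ! 1 * e) = (ys ! 0 * e, ys ! 1 * e)) \<longleftrightarrow> xs = ys"
      unfolding L using pos by auto
  next
    fix xs assume "xs \<in> ?L"
    then show "(xs ! 0 * e, xs ! 1 * e) \<in> ?A"
      unfolding L using pos gcd_scale by (auto simp: n)
  next
    fix p assume "p \<in> ?A"
    then obtain a b where p: "p = (a, b)" "a \<in> {1..n}" "b \<in> {1..n}"
      and g: "gcd (gcd a n) (gcd b n) = e" by auto
    have "e dvd a" "e dvd b" using g by (metis gcd_dvd1 gcd_dvd2 dvd_trans)+
    then obtain u v where uv: "a = u * e" "b = v * e" by (metis dvd_def mult.commute)
    have "gcd (gcd u d) (gcd v d) = 1" using g gcd_scale pos by (simp add: uv)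
    moreover have "u \<in> {1..d}" "v \<in> {1..d}" using p uv n pos by (auto simp: Suc_le_eq)
    ultimately show "\<exists>xs\<in>?L. p = (xs ! 0 * e, xs ! 1 * e)"
      unfolding L using p uv by (auto intro!: exI[of _ "[u, v]"] bexI[of _ "[u, v]"])
  qed
  then have "card ?L = card ?A" by (rule bij_betw_same_card)
  moreover have "n div d = e" using n pos by simp
  ultimately show ?thesis by (simp add: jordan_totient_def)
qed

section \<open>The orbicycle index of the cyclic group\<close>

theorem theorem5:
  fixes n :: nat and rep :: "(nat \<Rightarrow> nat) set \<Rightarrow> nat \<Rightarrow> nat"
  assumes "n \<ge> 1"
    and "is_class_rep (perm_group n (cyclic_perms n)) rep"
  shows "orbicycle_index n (cyclic_perms n) rep =
    poly_const (1 / of_nat n) *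
      (\<Sum>d | d dvd n. of_nat (jordan_totient 2 d) * poly_var d ^ (n div d))"
proof -
  interpret comm_group "perm_group n (cyclic_perms n)"
    using assms(1) by (rule comm_group_cyclic_perms)
  define w where "w g h = (\<Prod>k = 1..n. poly_var k ^ num_blocks k
    (partition_join {1..n} (cycle_partition n g) (cycle_partition n h)))" for g h
  define c where "c = (\<lambda>(a, b). gcd (gcd a n) (gcd b n))"
  let ?I = "{1..n} \<times> {1..n}"
  have c_dvd: "c p dvd n" for p by (auto simp: c_def split: prod.split intro: dvd_trans)
  have w: "w (translation n a) (translation n b) = poly_var (n div c (a, b)) ^ c (a, b)" for a b
    using prod_power_num_blocks_residue_partition[OF assms(1) c_dvd[of "(a, b)"], of poly_var]
    by (simp only: w_def c_def prod.case cycle_partition_translation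
        partition_join_residue_partition[OF assms(1) gcd_dvd2 gcd_dvd2])
  have div_iff: "n div c p = d \<longleftrightarrow> c p = n div d" if "d dvd n" for p d
    using that c_dvd[of p] assms(1) by (auto simp: div_div_eq_right dvd_pos_nat)
  have "(\<Sum>(C, h) \<in> commuting_class_pairs (perm_group n (cyclic_perms n)) rep.
      of_nat (card C) * w (rep C) h) = (\<Sum>g \<in> cyclic_perms n. \<Sum>h \<in> cyclic_perms n. w g h)"
    by (subst sum_commuting_class_pairs[OF _ assms(2)]) (simp_all add: cyclic_perms_def)
  also have "\<dots> = (\<Sum>a\<in>{1..n}. \<Sum>b\<in>{1..n}. w (translation n a) (translation n b))"
    by (simp only: cyclic_perms_def sum.reindex[OF inj_on_translation] o_def)
  also have "\<dots> = (\<Sum>p \<in> ?I. poly_var (n div c p) ^ c p)"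
    by (simp add: sum.cartesian_product w case_prod_unfold)
  also have "\<dots> = (\<Sum>d | d dvd n. \<Sum>p | p \<in> ?I \<and> n div c p = d. poly_var (n div c p) ^ c p)"
  proof (rule sum.group[symmetric])
    show "(\<lambda>p. n div c p) ` ?I \<subseteq> {d. d dvd n}"
      using dvd_div_mult_self[OF c_dvd] by (metis dvd_triv_left image_subsetI mem_Collect_eq)
  qed (use assms(1) in auto)
  also have "\<dots> = (\<Sum>d | d dvd n. of_nat (jordan_totient 2 d) * poly_var d ^ (n div d))"
  proof (rule sum.cong)
    fix d assume "d \<in> {d. d dvd n}"
    then have d: "d dvd n" by simp
    have "(\<Sum>p | p \<in> ?I \<and> n div c p = d. poly_var (n div c p) ^ c p) =
        (\<Sum>p | p \<in> ?I \<and> n div c p = d. poly_var d ^ (n div d))"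
    proof (rule sum.cong)
      fix p assume "p \<in> {p. p \<in> ?I \<and> n div c p = d}"
      then have "n div c p = d" by simp
      moreover from this have "c p = n div d" using div_iff[OF d] by simp
      ultimately show "poly_var (n div c p) ^ c p = poly_var d ^ (n div d)" by simp
    qed simp
    also have "\<dots> = of_nat (card {p. p \<in> ?I \<and> n div c p = d}) * poly_var d ^ (n div d)"
      by simp
    also have "card {p. p \<in> ?I \<and> n div c p = d} = jordan_totient 2 d"
      unfolding card_pairs_gcd_eq_jordan_totient[OF assms(1) d, symmetric]
      using div_iff[OF d] by (intro arg_cong[of _ _ card]) (auto simp: c_def)
    finally show "(\<Sum>p | p \<in> ?I \<and> n div c p = d. poly_var (n div c p) ^ c p) =
        of_nat (jordan_totient 2 d) * poly_var d ^ (n div d)" .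
  qed simp
  finally show ?thesis
    unfolding orbicycle_index_def by (simp add: w_def card_cyclic_perms)
qed

end
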